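(* Let $f\in\mathcal{B}$ with $f(z)=\sum_{n=0}^{\infty}a_nz^n$. Then $$|f(z)|+\sum_{n=1}^{\infty}|a_n|r^n+\left(\frac{1}{1+|a_0|}+\frac{r}{1-r}\right)\sum_{n=1}^{\infty}|a_n|^2r^{2n}\le 1\quad\text{for } |z|=r\le r_{a_0}:=\frac{2}{3+|a_0|+\sqrt5\,(1+|a_0|)}.$$ The radius $r_{a_0}$ is best possible and $r_{a_0}\ge\sqrt5-2$. Moreover, $$|f(z)|^2+\sum_{n=1}^{\infty}|a_n|r^n+\left(\frac{1}{1+|a_0|}+\frac{r}{1-r}\right)\sum_{n=1}^{\infty}|a_n|^2r^{2n}\le 1\quad\text{for } |z|=r\le r_{a_0}',$$ where $r_{a_0}'$ is the unique root in $(0,1)$ of the equation $$(1-|a_0|^2)r^3-(1+2|a_0|)r^2-2r+1=0.$$ The radius $r_{a_0}'$ is best possible. Further, $1/3<r_{a_0}'<1/(2+|a_0|)$.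
   Context: $\mathbb{D}=\{z\in\mathbb{C}:|z|<1\}$ and $\mathcal{B}$ is the set of all analytic functions $f:\mathbb{D}\to\mathbb{D}$ (so $|a_0|<1$). "Best possible" means: for every $a\in[0,1)$, the radius corresponding to $|a_0|=a$ cannot be replaced by any larger number so that the corresponding inequality still holds for all $f\in\mathcal{B}$ with $|f(0)|=a$. *)

theory Defs
  imports "HOL-Complex_Analysis.Complex_Analysis"
begin

definition class_B :: "(complex \<Rightarrow> complex) set" where
  "class_B = {f. f analytic_on ball 0 1 \<and> f ` ball 0 1 \<subseteq> ball 0 1}"

definition has_coeffs :: "(complex \<Rightarrow> complex) \<Rightarrow> (nat \<Rightarrow> complex) \<Rightarrow> bool" where
  "has_coeffs f a \<longleftrightarrow> (\<forall>z\<in>ball 0 1. (\<lambda>n. a n * z ^ n) sums f z)"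

text \<open>
  The exponent \<open>p\<close> of the leading term is 1 or 2. The series start at index 1, hence the
  shift by \<open>Suc\<close>. If \<open>has_coeffs f a\<close>, both series converge for \<open>cmod z < 1\<close>, so \<open>suminf\<close> is
  their genuine sum there.
\<close>
definition bohr_sum :: "nat \<Rightarrow> (complex \<Rightarrow> complex) \<Rightarrow> (nat \<Rightarrow> complex) \<Rightarrow> complex \<Rightarrow> real" where
  "bohr_sum p f a z =
     cmod (f z) ^ p
     + (\<Sum>n. cmod (a (Suc n)) * cmod z ^ Suc n)
     + (1 / (1 + cmod (a 0)) + cmod z / (1 - cmod z))
       * (\<Sum>n. (cmod (a (Suc n)))\<^sup>2 * cmod z ^ (2 * Suc n))"

definition radius1 :: "real \<Rightarrow> real" where
  "radius1 \<alpha> = 2 / (3 + \<alpha> + sqrt 5 * (1 + \<alpha>))"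

definition is_root2 :: "real \<Rightarrow> real \<Rightarrow> bool" where
  "is_root2 \<alpha> r \<longleftrightarrow>
     0 < r \<and> r < 1 \<and> (1 - \<alpha>\<^sup>2) * r ^ 3 - (1 + 2 * \<alpha>) * r\<^sup>2 - 2 * r + 1 = 0"

text \<open>Meaningful only when the root exists and is unique, which has to be established separately.\<close>
definition radius2 :: "real \<Rightarrow> real" where
  "radius2 \<alpha> = (THE r. is_root2 \<alpha> r)"

text \<open>
  The restriction of \<open>z\<close> to the unit disc only matters for \<open>R \<ge> 1\<close>; it keeps the left-hand
  side meaningful there.
\<close>
definition bohr_holds :: "nat \<Rightarrow> real \<Rightarrow> real \<Rightarrow> bool" where
  "bohr_holds p \<alpha> R \<longleftrightarrow>
     (\<forall>f\<in>class_B. \<forall>a. has_coeffs f a \<longrightarrow> cmod (f 0) = \<alpha> \<longrightarrow>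
        (\<forall>z\<in>ball 0 1. cmod z \<le> R \<longrightarrow> bohr_sum p f a z \<le> 1))"

definition best_possible :: "nat \<Rightarrow> (real \<Rightarrow> real) \<Rightarrow> bool" where
  "best_possible p \<rho> \<longleftrightarrow> (\<forall>\<alpha>\<in>{0..<1}. \<forall>R>\<rho> \<alpha>. \<not> bohr_holds p \<alpha> R)"

end

theory Submission
  imports Defs
begin

text \<open>
  The lower triangular Toeplitz matrix of the coefficients of a function bounded by 1 is a
  contraction (average over roots of unity, then let the radius tend to 1). Suitable test vectors give
  Carlson's inequalities
  \<open>\<bar>a\<^bsub>2n+1\<^esub>\<bar> \<le> 1 - \<Sum>\<^bsub>k\<le>n\<^esub> \<bar>a\<^sub>k\<bar>\<^sup>2\<close> and
  \<open>\<bar>a\<^bsub>2n\<^esub>\<bar> \<le> 1 - \<Sum>\<^bsub>k<n\<^esub> \<bar>a\<^sub>k\<bar>\<^sup>2 - \<bar>a\<^sub>n\<bar>\<^sup>2 / (1 + \<bar>a\<^sub>0\<bar>)\<close>.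
  Weighted by \<open>r\<^sup>n\<close> and summed, they bound the two series of the Bohr sum by
  \<open>(1 - \<bar>a\<^sub>0\<bar>\<^sup>2) r / (1 - r)\<close>, and the Schwarz-Pick lemma bounds \<open>\<bar>f z\<bar>\<close> by
  \<open>(r + \<bar>a\<^sub>0\<bar>) / (1 + \<bar>a\<^sub>0\<bar> r)\<close>. The function \<open>(\<alpha> - z) / (1 - \<alpha> z)\<close> attains both bounds at
  \<open>z = - r\<close> for every \<open>r\<close>, so both radii are determined by comparing this majorant with 1.
\<close>

subsection \<open>Averages over roots of unity\<close>

text \<open>Averages over the powers of this root stand in for integrals over the unit circle, so
  that Parseval's identity and Fourier coefficients reduce to finite sums.\<close>

definition unit_root :: "nat \<Rightarrow> complex" where
  "unit_root M = exp (2 * of_real pi * \<i> / of_nat M)"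

lemma norm_unit_root [simp]: "norm (unit_root M) = 1"
  by (simp add: unit_root_def)

lemma unit_root_power: "unit_root M ^ j = exp (2 * of_real pi * \<i> * of_nat j / of_nat M)"
  unfolding unit_root_def by (subst exp_of_nat_mult [symmetric]) (simp add: algebra_simps)

lemma unit_root_power_self: "M > 0 \<Longrightarrow> unit_root M ^ M = 1"
  by (simp add: unit_root_power)

lemma unit_root_power_eq_iff:
  assumes "i < M" "j < M"
  shows "unit_root M ^ i = unit_root M ^ j \<longleftrightarrow> i = j"
proof -
  have "1 \<le> M" using assms by auto
  from complex_root_unity_eq [OF this, of i j] assms show ?thesis
    by (simp add: unit_root_power cong_def)
qed

text \<open>The summands are powers of \<open>q = w ^ j * cnj (w ^ i)\<close>, so this is a
  geometric sum with \<open>q ^ M = 1\<close>; and \<open>q\<close> differs from 1 when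
  \<open>i\<close> and \<open>j\<close> do, because both are below \<open>M\<close>.\<close>

lemma unit_root_orthogonality:
  assumes "i < M" "j < M"
  shows "(\<Sum>k<M. (unit_root M ^ k) ^ j * cnj ((unit_root M ^ k) ^ i)) = (if i = j then of_nat M else 0)"
proof -
  define w where "w = unit_root M"
  define q where "q = w ^ j * cnj (w ^ i)"
  have M: "M > 0" using assms by auto
  have nw: "w ^ n * cnj (w ^ n) = 1" for n
    by (metis complex_norm_square norm_power norm_unit_root of_real_1 one_power2 power_one w_def)
  have "(w ^ k) ^ j * cnj ((w ^ k) ^ i) = q ^ k" for k
    by (simp add: q_def power_mult_distrib mult.commute flip: power_mult)
  then have *: "(\<Sum>k<M. (w ^ k) ^ j * cnj ((w ^ k) ^ i)) = (\<Sum>k<M. q ^ k)" by simp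
  have wM: "w ^ M = 1"
    using M unit_root_power_self w_def by simp
  have qM: "q ^ M = (w ^ M) ^ j * cnj ((w ^ M) ^ i)"
    by (simp add: q_def power_mult_distrib mult.commute flip: power_mult)
  show ?thesis
  proof (cases "i = j")
    case True
    then have "q = 1" using nw by (simp add: q_def)
    then show ?thesis using * True by (simp add: w_def)
  next
    case False
    have "q \<noteq> 1"
    proof
      assume "q = 1"
      then have "q * w ^ i = w ^ i" by simp
      then have "w ^ j * (w ^ i * cnj (w ^ i)) = w ^ i" by (simp only: q_def mult_ac)
      then have "w ^ j = w ^ i" by (simp only: nw mult_1_right)
      with False show False using unit_root_power_eq_iff assms by (simp add: w_def)
    qed
    then have "(\<Sum>k<M. q ^ k) = 0"
      by (subst geometric_sum) (simp_all add: qM wM)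
    then show ?thesis using * False by (simp add: w_def)
  qed
qed

text \<open>Expanding the squares gives a double sum of which orthogonality keeps the diagonal;
  \<open>N < M\<close> prevents distinct exponents from agreeing modulo \<open>M\<close>.\<close>

lemma unit_root_parseval:
  assumes "N < M"
  shows "(\<Sum>k<M. (cmod (\<Sum>j\<le>N. x j * (unit_root M ^ k) ^ j))\<^sup>2) = of_nat M * (\<Sum>j\<le>N. (cmod (x j))\<^sup>2)"
proof -
  let ?z = "\<lambda>k. unit_root M ^ k"
  have "complex_of_real (\<Sum>k<M. (cmod (\<Sum>j\<le>N. x j * ?z k ^ j))\<^sup>2)
      = (\<Sum>k<M. (\<Sum>j\<le>N. x j * ?z k ^ j) * cnj (\<Sum>i\<le>N. x i * ?z k ^ i))"
    by (simp only: of_real_sum complex_norm_square)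
  also have "\<dots> = (\<Sum>k<M. \<Sum>j\<le>N. \<Sum>i\<le>N. x j * cnj (x i) * (?z k ^ j * cnj (?z k ^ i)))"
    by (simp add: sum_product mult_ac)
  also have "\<dots> = (\<Sum>j\<le>N. \<Sum>i\<le>N. \<Sum>k<M. x j * cnj (x i) * (?z k ^ j * cnj (?z k ^ i)))"
    by (subst sum.swap, rule sum.cong [OF refl], subst sum.swap, simp)
  also have "\<dots> = (\<Sum>j\<le>N. \<Sum>i\<le>N. if i = j then of_nat M * (x j * cnj (x i)) else 0)"
    using assms by (intro sum.cong refl, subst sum_distrib_left [symmetric],
        subst unit_root_orthogonality) auto
  also have "\<dots> = complex_of_real (of_nat M * (\<Sum>j\<le>N. (cmod (x j))\<^sup>2))"
    by (simp add: sum.delta sum_distrib_left complex_norm_square of_real_sum del: of_real_power)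
  finally show ?thesis using of_real_eq_iff by blast
qed

text \<open>Recovery of a Fourier coefficient: once \<open>i < M\<close>, the terms of index below
  \<open>M\<close> contribute exactly \<open>b i\<close> by orthogonality, and the others at most
  the tail of an absolutely convergent series.\<close>

lemma unit_root_average_tendsto:
  fixes b :: "nat \<Rightarrow> complex"
  assumes "summable (\<lambda>n. cmod (b n))" and "\<And>z. cmod z = 1 \<Longrightarrow> (\<lambda>n. b n * z ^ n) sums g z"
  shows "(\<lambda>M. (\<Sum>k<M. g (unit_root M ^ k) * cnj ((unit_root M ^ k) ^ i)) / of_nat M) \<longlonglongrightarrow> b i"
proof (rule LIM_zero_cancel, rule Lim_null_comparison)
  have "(\<lambda>M. (\<Sum>n. cmod (b n)) - (\<Sum>n<M. cmod (b n))) \<longlonglongrightarrow> (\<Sum>n. cmod (b n)) - (\<Sum>n. cmod (b n))"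
    by (intro tendsto_diff tendsto_const summable_LIMSEQ assms)
  then show "(\<lambda>M. \<Sum>n. cmod (b (n + M))) \<longlonglongrightarrow> 0"
    using suminf_minus_initial_segment [OF assms(1)] by simp
  show "\<forall>\<^sub>F M in sequentially.
    cmod ((\<Sum>k<M. g (unit_root M ^ k) * cnj ((unit_root M ^ k) ^ i)) / of_nat M - b i)
      \<le> (\<Sum>n. cmod (b (n + M)))"
    using eventually_gt_at_top [of i]
  proof eventually_elim
    case (elim M)
    let ?z = "\<lambda>k. unit_root M ^ k"
    let ?T = "\<lambda>z. \<Sum>n. b (n + M) * z ^ (n + M)"
    have nz: "cmod (?z k) = 1" for k by (simp add: norm_power)
    have g: "g z = ?T z + (\<Sum>n<M. b n * z ^ n)" if "cmod z = 1" for z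
      using suminf_split_initial_segment [of "\<lambda>n. b n * z ^ n" M] assms(2) [OF that]
      by (simp add: sums_iff)
    have T: "cmod (?T z) \<le> (\<Sum>n. cmod (b (n + M)))" if "cmod z = 1" for z
    proof -
      have s: "summable (\<lambda>n. cmod (b (n + M)))" 
        using summable_iff_shift [of "\<lambda>n. cmod (b n)" M] assms(1) by simp
      have e: "cmod (b (n + M) * z ^ (n + M)) = cmod (b (n + M))" for n
        using that by (simp add: norm_mult norm_power)
      show ?thesis using summable_norm [of "\<lambda>n. b (n + M) * z ^ (n + M)"] s unfolding e by simp
    qed
    have "(\<Sum>k<M. (\<Sum>n<M. b n * ?z k ^ n) * cnj (?z k ^ i))
        = (\<Sum>k<M. \<Sum>n<M. b n * (?z k ^ n * cnj (?z k ^ i)))"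
      by (simp only: sum_distrib_right mult.assoc)
    also have "\<dots> = (\<Sum>n<M. \<Sum>k<M. b n * (?z k ^ n * cnj (?z k ^ i)))"
      by (rule sum.swap)
    also have "\<dots> = (\<Sum>n<M. b n * (\<Sum>k<M. ?z k ^ n * cnj (?z k ^ i)))"
      by (simp only: sum_distrib_left)
    also have "\<dots> = (\<Sum>n<M. if i = n then b n * of_nat M else 0)"
      using elim by (intro sum.cong refl, subst unit_root_orthogonality) auto
    also have "\<dots> = b i * of_nat M" using elim by (simp add: sum.delta')
    finally have main: "(\<Sum>k<M. (\<Sum>n<M. b n * ?z k ^ n) * cnj (?z k ^ i)) = b i * of_nat M" .
    have "(\<Sum>k<M. g (?z k) * cnj (?z k ^ i)) = (\<Sum>k<M. ?T (?z k) * cnj (?z k ^ i)) + b i * of_nat M"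
      unfolding main [symmetric] by (simp add: g [OF nz] distrib_right sum.distrib)
    then have "(\<Sum>k<M. g (?z k) * cnj (?z k ^ i)) / of_nat M - b i
        = (\<Sum>k<M. ?T (?z k) * cnj (?z k ^ i)) / of_nat M"
      using elim by (simp add: field_simps)
    moreover have "cmod (\<Sum>k<M. ?T (?z k) * cnj (?z k ^ i)) \<le> (\<Sum>k<M. \<Sum>n. cmod (b (n + M)))"
      by (intro sum_norm_le) (use T [OF nz] in \<open>simp add: norm_mult norm_power\<close>)
    ultimately show ?case
      using elim by (simp add: norm_divide field_simps)
  qed
qed

text \<open>The pairing on the left is the limit of averages of \<open>h * X * cnj Y\<close> with
  the polynomials \<open>X\<close> and \<open>Y\<close> built from \<open>x\<close> and
  \<open>y\<close>. Each such value is at most the mean of the two squared moduli, which Parseval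
  averages. The arithmetic mean loses nothing later, where both test vectors have the same
  norm.\<close>

lemma contraction_on_circle:
  fixes b x y :: "nat \<Rightarrow> complex"
  assumes "summable (\<lambda>n. cmod (b n))"
    and "\<And>z. cmod z = 1 \<Longrightarrow> (\<lambda>n. b n * z ^ n) sums (h z * (\<Sum>j\<le>N. x j * z ^ j))"
    and "\<And>z. cmod z = 1 \<Longrightarrow> cmod (h z) \<le> 1"
  shows "Re (\<Sum>i\<le>N. cnj (y i) * b i) \<le> ((\<Sum>j\<le>N. (cmod (x j))\<^sup>2) + (\<Sum>i\<le>N. (cmod (y i))\<^sup>2)) / 2"
proof -
  define X where "X z = (\<Sum>j\<le>N. x j * z ^ j)" for z
  define Y where "Y z = (\<Sum>j\<le>N. y j * z ^ j)" for z
  let ?z = "\<lambda>M k. unit_root M ^ k"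
  let ?A = "\<lambda>M. (\<Sum>k<M. h (?z M k) * X (?z M k) * cnj (Y (?z M k))) / of_nat M"
  have "(\<lambda>M. \<Sum>i\<le>N. cnj (y i) * ((\<Sum>k<M. h (?z M k) * X (?z M k) * cnj (?z M k ^ i)) / of_nat M))
      \<longlonglongrightarrow> (\<Sum>i\<le>N. cnj (y i) * b i)"
    using assms(2) unfolding X_def [symmetric]
    by (intro tendsto_sum tendsto_mult tendsto_const unit_root_average_tendsto assms(1))
  moreover have "(\<Sum>i\<le>N. cnj (y i) * ((\<Sum>k<M. h (?z M k) * X (?z M k) * cnj (?z M k ^ i)) / of_nat M))
      = ?A M" for M
    by (simp add: Y_def sum_distrib_left sum_divide_distrib mult_ac sum.swap [of _ "{..N}" "{..<M}"])
  ultimately have "?A \<longlonglongrightarrow> (\<Sum>i\<le>N. cnj (y i) * b i)" by simp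
  then have "(\<lambda>M. Re (?A M)) \<longlonglongrightarrow> Re (\<Sum>i\<le>N. cnj (y i) * b i)" by (rule tendsto_Re)
  then show ?thesis
  proof (rule tendsto_upperbound)
    show "\<forall>\<^sub>F M in sequentially. Re (?A M)
        \<le> ((\<Sum>j\<le>N. (cmod (x j))\<^sup>2) + (\<Sum>i\<le>N. (cmod (y i))\<^sup>2)) / 2"
      using eventually_gt_at_top [of N]
    proof eventually_elim
      case (elim M)
      have "Re (h z * X z * cnj (Y z)) \<le> ((cmod (X z))\<^sup>2 + (cmod (Y z))\<^sup>2) / 2" if "cmod z = 1" for z
      proof -
        have "Re (h z * X z * cnj (Y z)) \<le> cmod (h z) * (cmod (X z) * cmod (Y z))"
          by (metis complex_Re_le_cmod complex_mod_cnj mult.assoc norm_mult)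
        also have "\<dots> \<le> 1 * (cmod (X z) * cmod (Y z))"
          using assms(3) [OF that] by (intro mult_right_mono) auto
        also have "\<dots> \<le> ((cmod (X z))\<^sup>2 + (cmod (Y z))\<^sup>2) / 2"
          using sum_squares_bound [of "cmod (X z)" "cmod (Y z)"] by simp
        finally show ?thesis .
      qed
      then have "Re (\<Sum>k<M. h (?z M k) * X (?z M k) * cnj (Y (?z M k)))
          \<le> (\<Sum>k<M. ((cmod (X (?z M k)))\<^sup>2 + (cmod (Y (?z M k)))\<^sup>2) / 2)"
        unfolding Re_sum by (intro sum_mono) (simp add: norm_power)
      also have "\<dots> = of_nat M * (((\<Sum>j\<le>N. (cmod (x j))\<^sup>2) + (\<Sum>i\<le>N. (cmod (y i))\<^sup>2)) / 2)"
        using elim by (simp add: X_def Y_def unit_root_parseval sum.distrib distrib_left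
            flip: sum_divide_distrib)
      finally show ?case using elim by (simp add: field_simps)
    qed
  qed simp
qed

subsection \<open>Carlson's inequalities\<close>

lemma has_coeffs_0:
  assumes "has_coeffs f a"
  shows "f 0 = a 0"
proof -
  have "(\<lambda>n. a n * 0 ^ n) sums f 0"
    using assms unfolding has_coeffs_def by (metis centre_in_ball zero_less_one)
  moreover have "(\<lambda>n. a n * 0 ^ n) sums a 0"
    by (rule powser_sums_zero)
  ultimately show ?thesis by (rule sums_unique2)
qed

lemma has_coeffs_abs_summable:
  assumes "has_coeffs f a" "cmod z < 1"
  shows "summable (\<lambda>n. cmod (a n * z ^ n))"
proof (rule powser_insidea)
  \<comment> \<open>The midpoint still lies in the disc, and convergence there forces absolute
    convergence at points of smaller modulus.\<close>
  let ?r = "(cmod z + 1) / 2"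
  show "summable (\<lambda>n. a n * complex_of_real ?r ^ n)"
    using assms by (auto simp: has_coeffs_def sums_iff simp del: of_real_power of_real_divide of_real_add)
  show "cmod z < cmod (complex_of_real ?r)" using assms
    by (simp del: of_real_power of_real_divide of_real_add)
qed

text \<open>On the unit circle itself the power series may diverge. The circle bound is therefore
  applied to the dilation \<open>f (r * z)\<close> with \<open>r < 1\<close>; only finitely many
  coefficients enter, so \<open>r\<close> can tend to 1.\<close>

lemma toeplitz_contraction:
  assumes coeffs: "has_coeffs f a" and bound: "\<And>z. cmod z < 1 \<Longrightarrow> cmod (f z) \<le> 1"
  shows "Re (\<Sum>i\<le>N. cnj (y i) * (\<Sum>j\<le>i. x j * a (i - j)))
    \<le> ((\<Sum>j\<le>N. (cmod (x j))\<^sup>2) + (\<Sum>i\<le>N. (cmod (y i))\<^sup>2)) / 2"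
proof -
  define F where "F = (\<lambda>r::real. Re (\<Sum>i\<le>N. cnj (y i) * (\<Sum>j\<le>i. x j * (a (i - j) * of_real r ^ (i - j)))))"
  have "(F \<longlongrightarrow> F 1) (at_left 1)"
    unfolding F_def by (intro tendsto_intros)
  moreover have "\<forall>\<^sub>F r in at_left 1. F r \<le> ((\<Sum>j\<le>N. (cmod (x j))\<^sup>2) + (\<Sum>i\<le>N. (cmod (y i))\<^sup>2)) / 2"
    using eventually_at_left_real [of 0 1, simplified]
  proof eventually_elim
    case (elim r)
    \<comment> \<open>Padding by zeros turns the vector into a power series, and the Toeplitz
      product becomes a Cauchy product. Rows up to \<open>N\<close> see only the original
      entries.\<close>
    define x' where "x' j = (if j \<le> N then x j else 0)" for j
    define c where "c n = a n * of_real r ^ n" for n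
    define b where "b n = (\<Sum>j\<le>n. x' j * c (n - j))" for n
    have sx: "summable (\<lambda>n. cmod (x' n * z ^ n))" for z
      by (rule summable_finite [of "{..N}"]) (auto simp: x'_def)
    have sc: "summable (\<lambda>n. cmod (c n))"
      unfolding c_def using elim by (intro has_coeffs_abs_summable [OF coeffs]) auto
    have "Re (\<Sum>i\<le>N. cnj (y i) * b i)
      \<le> ((\<Sum>j\<le>N. (cmod (x j))\<^sup>2) + (\<Sum>i\<le>N. (cmod (y i))\<^sup>2)) / 2"
    proof (rule contraction_on_circle)
      show "summable (\<lambda>n. cmod (b n))"
      proof (rule summable_comparison_test')
        show "summable (\<lambda>n. \<Sum>j\<le>n. cmod (x' j) * cmod (c (n - j)))"
          using sx [of 1] sc by (intro summable_Cauchy_product) auto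
        show "norm (cmod (b n)) \<le> (\<Sum>j\<le>n. cmod (x' j) * cmod (c (n - j)))" for n
          unfolding b_def by (auto intro: sum_norm_le simp: norm_mult)
      qed
    next
      fix z :: complex assume z: "cmod z = 1"
      have "(\<lambda>n. \<Sum>j\<le>n. (x' j * z ^ j) * (c (n - j) * z ^ (n - j))) sums
          ((\<Sum>n. x' n * z ^ n) * (\<Sum>n. c n * z ^ n))"
        using sx [of 1] sc z by (intro Cauchy_product_sums) (simp_all add: norm_mult norm_power)
      moreover have "(\<Sum>n. x' n * z ^ n) = (\<Sum>j\<le>N. x j * z ^ j)"
        by (subst suminf_finite [of "{..N}"]) (auto simp: x'_def)
      moreover have "(\<Sum>n. c n * z ^ n) = f (of_real r * z)"
      proof -
        have "of_real r * z \<in> ball 0 1" using elim z by (simp add: norm_mult)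
        then have "(\<lambda>n. a n * (of_real r * z) ^ n) sums f (of_real r * z)"
          using coeffs unfolding has_coeffs_def by blast
        then show ?thesis by (simp add: c_def power_mult_distrib mult.assoc sums_iff)
      qed
      moreover have "(\<Sum>j\<le>n. (x' j * z ^ j) * (c (n - j) * z ^ (n - j))) = b n * z ^ n" for n
        unfolding b_def sum_distrib_right
      proof (intro sum.cong refl)
        fix j assume "j \<in> {..n}"
        then have "z ^ n = z ^ j * z ^ (n - j)" by (simp flip: power_add)
        then show "(x' j * z ^ j) * (c (n - j) * z ^ (n - j)) = x' j * c (n - j) * z ^ n" by simp
      qed
      ultimately show "(\<lambda>n. b n * z ^ n) sums (f (of_real r * z) * (\<Sum>j\<le>N. x j * z ^ j))"
        by (simp add: mult.commute)
      show "cmod (f (of_real r * z)) \<le> 1" using elim z by (intro bound) (simp add: norm_mult)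
    qed
    moreover have "Re (\<Sum>i\<le>N. cnj (y i) * b i) = F r"
      unfolding F_def b_def c_def x'_def by (intro arg_cong [of _ _ Re] sum.cong refl arg_cong2 [of _ _ _ _ "(*)"]) auto
    ultimately show ?case by simp
  qed
  ultimately have "F 1 \<le> ((\<Sum>j\<le>N. (cmod (x j))\<^sup>2) + (\<Sum>i\<le>N. (cmod (y i))\<^sup>2)) / 2"
    by (rule tendsto_upperbound) simp
  then show ?thesis by (simp add: F_def)
qed

text \<open>
  The Toeplitz contraction is tested on \<open>x = s e\<^sub>0 + \<Sum> t\<^sub>k cnj (a\<^sub>k) e\<^bsub>N-k\<^esub>\<close> and
  \<open>y = e\<^sub>N + s \<Sum> t\<^sub>k a\<^sub>k e\<^sub>k\<close>: row \<open>N\<close> and column 0 each contribute \<open>\<Sum> t\<^sub>k \<bar>a\<^sub>k\<bar>\<^sup>2\<close>, and the double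
  sum collects the remaining block, which vanishes for \<open>2K < N\<close> and has one entry for \<open>2K = N\<close>.
\<close>
lemma carlson_bilinear:
  fixes t :: "nat \<Rightarrow> real" and s :: complex
  assumes "K < N" and s: "cmod s = 1"
    and coeffs: "has_coeffs f a" and bound: "\<And>z. cmod z < 1 \<Longrightarrow> cmod (f z) \<le> 1"
  shows "Re (s * a N) + 2 * (\<Sum>k\<le>K. t k * (cmod (a k))\<^sup>2)
     + Re (\<Sum>k\<le>K. \<Sum>l\<le>K. if N \<le> k + l then cnj s * t k * t l * cnj (a k) * cnj (a l) * a (k + l - N) else 0)
    \<le> 1 + (\<Sum>k\<le>K. (t k)\<^sup>2 * (cmod (a k))\<^sup>2)"
proof -
  \<comment> \<open>\<open>A\<close> is the Toeplitz matrix. Since \<open>K < N\<close>, the vector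
    \<open>u\<close> vanishes at \<open>N\<close>; hence the special entries \<open>x 0 = s\<close>
    and \<open>y N = 1\<close> each replace a zero and can be split off any sum over the
    entries.\<close>
  define A where "A i j = (if j \<le> i then a (i - j) else 0)" for i j
  define u where "u k = (if k \<le> K then t k * a k else 0)" for k
  define x where "x j = (if j = 0 then s else cnj (u (N - j)))" for j
  define y where "y i = (if i = N then 1 else s * u i)" for i
  have u0: "u N = 0" using assms by (simp add: u_def)
  have rest: "(\<Sum>k\<le>N. G (u k) k) = (\<Sum>k\<le>K. G (t k * a k) k)" if "\<And>k. G 0 k = 0"
    for G :: "complex \<Rightarrow> nat \<Rightarrow> 'b::comm_monoid_add"
    using assms that by (intro sum.mono_neutral_cong_right) (auto simp: u_def)
  have x_split: "(\<Sum>j\<le>N. G (x j) j) = G s 0 + (\<Sum>k\<le>N. G (cnj (u k)) (N - k))" if "\<And>k. G 0 k = 0"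
    for G :: "complex \<Rightarrow> nat \<Rightarrow> 'b::comm_monoid_add"
  proof -
    have "(\<Sum>k\<le>N. G (cnj (u k)) (N - k)) = (\<Sum>j\<le>N. G (cnj (u (N - j))) j)"
      by (rule sum.reindex_bij_witness [of _ "\<lambda>j. N - j" "\<lambda>j. N - j"]) auto
    also have "\<dots> = G (cnj (u N)) 0 + (\<Sum>j\<in>{..N} - {0}. G (cnj (u (N - j))) j)"
      by (subst sum.remove [of _ 0]) auto
    finally show ?thesis
      by (subst sum.remove [of _ 0]) (auto simp: x_def u0 that intro!: sum.cong)
  qed
  have y_split: "(\<Sum>j\<le>N. G (y j) j) = G 1 N + (\<Sum>k\<le>N. G (s * u k) k)" if "\<And>k. G 0 k = 0"
    for G :: "complex \<Rightarrow> nat \<Rightarrow> 'b::comm_monoid_add"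
  proof -
    have "(\<Sum>k\<le>N. G (s * u k) k) = G (s * u N) N + (\<Sum>j\<in>{..N} - {N}. G (s * u j) j)"
      by (subst sum.remove [of _ N]) auto
    then show ?thesis
      by (subst sum.remove [of _ N]) (auto simp: y_def u0 that intro!: sum.cong)
  qed
  let ?S = "\<Sum>k\<le>K. (t k)\<^sup>2 * (cmod (a k))\<^sup>2"
  have nx: "(\<Sum>j\<le>N. (cmod (x j))\<^sup>2) = 1 + ?S"
    using x_split [of "\<lambda>w _. (cmod w)\<^sup>2"] rest [of "\<lambda>w _. (cmod w)\<^sup>2"]
    by (simp add: s norm_mult power_mult_distrib)
  have ny: "(\<Sum>j\<le>N. (cmod (y j))\<^sup>2) = 1 + ?S"
    using y_split [of "\<lambda>w _. (cmod w)\<^sup>2"] rest [of "\<lambda>w _. (cmod w)\<^sup>2"]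
    by (simp add: s norm_mult power_mult_distrib)
  have inner: "(\<Sum>j\<le>i. x j * a (i - j)) = s * a i + (\<Sum>l\<le>K. cnj (t l * a l) * A i (N - l))" if "i \<le> N" for i
  proof -
    have "(\<Sum>j\<le>i. x j * a (i - j)) = (\<Sum>j\<le>N. x j * A i j)"
      using that by (intro sum.mono_neutral_cong_left) (auto simp: A_def)
    also have "\<dots> = s * a i + (\<Sum>k\<le>N. cnj (u k) * A i (N - k))"
      by (subst x_split) (auto simp: A_def)
    also have "(\<Sum>k\<le>N. cnj (u k) * A i (N - k)) = (\<Sum>l\<le>K. cnj (t l * a l) * A i (N - l))"
      by (subst rest [of "\<lambda>w k. cnj w * A i (N - k)"]) auto
    finally show ?thesis .
  qed
  let ?I = "\<lambda>i. s * a i + (\<Sum>l\<le>K. cnj (t l * a l) * A i (N - l))"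
  have ss: "s * cnj s = 1" using s complex_norm_square [of s] by simp
  have sq: "cnj z * z = of_real ((cmod z)\<^sup>2)" for z
    by (subst complex_norm_square) simp
  have "(\<Sum>i\<le>N. cnj (y i) * (\<Sum>j\<le>i. x j * a (i - j))) = (\<Sum>i\<le>N. cnj (y i) * ?I i)"
    by (intro sum.cong refl) (simp add: inner)
  also have "\<dots> = ?I N + (\<Sum>k\<le>N. cnj (s * u k) * ?I k)"
    by (subst y_split) auto
  also have "(\<Sum>k\<le>N. cnj (s * u k) * ?I k) = (\<Sum>k\<le>K. cnj (s * (t k * a k)) * ?I k)"
    by (subst rest [of "\<lambda>w k. cnj (s * w) * ?I k"]) auto
  also have "?I N = s * a N + of_real (\<Sum>k\<le>K. t k * (cmod (a k))\<^sup>2)"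
  proof -
    have "cnj (t l * a l) * A N (N - l) = of_real (t l * (cmod (a l))\<^sup>2)" if "l \<le> K" for l
      using that \<open>K < N\<close> by (simp add: A_def sq mult.assoc del: of_real_power)
    then have "(\<Sum>l\<le>K. cnj (t l * a l) * A N (N - l)) = of_real (\<Sum>l\<le>K. t l * (cmod (a l))\<^sup>2)"
      unfolding of_real_sum by (intro sum.cong refl) simp_all
    then show ?thesis by (simp only:)
  qed
  \<comment> \<open>The rotation cancels in column 0, which yields the second copy of the weighted
    sum. The entry in row \<open>k\<close> and column \<open>N - l\<close> is on or below the
    diagonal exactly when \<open>N \<le> k + l\<close>.\<close>
  also have "(\<Sum>k\<le>K. cnj (s * (t k * a k)) * ?I k) = of_real (\<Sum>k\<le>K. t k * (cmod (a k))\<^sup>2)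
     + (\<Sum>k\<le>K. \<Sum>l\<le>K. if N \<le> k + l then cnj s * t k * t l * cnj (a k) * cnj (a l) * a (k + l - N) else 0)"
    (is "_ = _ + ?E")
  proof -
    have "cnj (s * (t k * a k)) * (s * a k) = of_real (t k * (cmod (a k))\<^sup>2)" for k
    proof -
      have "cnj (s * (t k * a k)) * (s * a k) = (s * cnj s) * of_real (t k) * (cnj (a k) * a k)"
        by (simp add: mult_ac)
      then show ?thesis unfolding ss sq by (simp del: of_real_power)
    qed
    moreover have "cnj (s * (t k * a k)) * (cnj (t l * a l) * A k (N - l)) =
        (if N \<le> k + l then cnj s * t k * t l * cnj (a k) * cnj (a l) * a (k + l - N) else 0)"
      if "l \<le> K" for k l
    proof (cases "N \<le> k + l")
      case True
      \<comment> \<open>The subtraction is truncated; \<open>l \<le> K < N\<close> justifies the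
        rearrangement.\<close>
      then have "k - (N - l) = k + l - N" "N - l \<le> k" using that \<open>K < N\<close> by auto
      then show ?thesis using True by (simp add: A_def mult_ac)
    next
      case False
      then show ?thesis by (simp add: A_def)
    qed
    ultimately show ?thesis
      by (simp only: distrib_left sum.distrib sum_distrib_left of_real_sum cong: sum.cong) simp
  qed
  finally have "(\<Sum>i\<le>N. cnj (y i) * (\<Sum>j\<le>i. x j * a (i - j)))
     = s * a N + of_real (\<Sum>k\<le>K. t k * (cmod (a k))\<^sup>2) + (of_real (\<Sum>k\<le>K. t k * (cmod (a k))\<^sup>2) + ?E)" .
  then have split: "Re (\<Sum>i\<le>N. cnj (y i) * (\<Sum>j\<le>i. x j * a (i - j)))
     = Re (s * a N) + 2 * (\<Sum>k\<le>K. t k * (cmod (a k))\<^sup>2) + Re ?E"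
    by (simp only: plus_complex.sel Re_complex_of_real)
  have "Re (\<Sum>i\<le>N. cnj (y i) * (\<Sum>j\<le>i. x j * a (i - j))) \<le> ((1 + ?S) + (1 + ?S)) / 2"
    using toeplitz_contraction [OF coeffs bound, where N = N and x = x and y = y] unfolding nx ny .
  then show ?thesis unfolding split by (simp only: field_sum_of_halves add_divide_distrib)
qed

text \<open>Supplies the factor \<open>s\<close> that turns \<open>Re (s * a N)\<close> into
  \<open>cmod (a N)\<close>.\<close>

lemma exists_unimodular_rotation:
  obtains s where "cmod s = 1" "s * z = of_real (cmod z)"
proof (cases "z = 0")
  case True
  then show ?thesis using that [of 1] by simp
next
  case False
  have "cnj (sgn z) * z = (z * cnj z) / of_real (cmod z)"
    by (simp add: sgn_eq mult.commute)
  also have "\<dots> = of_real (cmod z)"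
    using False by (simp add: power2_eq_square flip: complex_norm_square)
  finally have "cnj (sgn z) * z = of_real (cmod z)" .
  then show ?thesis using that [of "cnj (sgn z)"] False by (simp add: norm_sgn)
qed

text \<open>With unit weights, \<open>K = n\<close> and \<open>N = 2 * n + 1\<close>, the remaining
  block is empty. The sum of squares occurs twice on the left and once on the right, which leaves
  one copy.\<close>

lemma carlson_odd:
  assumes "has_coeffs f a" "\<And>z. cmod z < 1 \<Longrightarrow> cmod (f z) \<le> 1"
  shows "cmod (a (2 * n + 1)) \<le> 1 - (\<Sum>k\<le>n. (cmod (a k))\<^sup>2)"
proof -
  obtain s where s: "cmod s = 1" "s * a (2 * n + 1) = of_real (cmod (a (2 * n + 1)))"
    by (rule exists_unimodular_rotation)
  have "(\<Sum>k\<le>n. \<Sum>l\<le>n. if 2 * n + 1 \<le> k + l then cnj s * of_real 1 * of_real 1 * cnj (a k) * cnj (a l) * a (k + l - (2 * n + 1)) else 0) = 0"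
    by (intro sum.neutral ballI) auto
  then show ?thesis
    using carlson_bilinear [of n "2 * n + 1" s f a "\<lambda>_. 1", OF _ s(1) assms]
    unfolding s(2) by simp
qed

text \<open>With \<open>K = n\<close> and \<open>N = 2 * n\<close> the block has the single entry
  \<open>k = l = n\<close>, of modulus
  \<open>\<tau>\<^sup>2 * (cmod (a n))\<^sup>2 * cmod (a 0)\<close>. The weight at \<open>n\<close>
  is chosen to minimise the resulting factor
  \<open>\<tau>\<^sup>2 * (1 + cmod (a 0)) - 2 * \<tau>\<close>; the minimum is
  \<open>- \<tau>\<close>.\<close>

lemma carlson_even:
  assumes "has_coeffs f a" "\<And>z. cmod z < 1 \<Longrightarrow> cmod (f z) \<le> 1" and "n > 0"
  shows "cmod (a (2 * n)) \<le> 1 - (\<Sum>k<n. (cmod (a k))\<^sup>2) - (cmod (a n))\<^sup>2 / (1 + cmod (a 0))"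
proof -
  define \<tau> where "\<tau> = 1 / (1 + cmod (a 0))"
  define t where "t k = (if k = n then \<tau> else 1)" for k
  obtain s where s: "cmod s = 1" "s * a (2 * n) = of_real (cmod (a (2 * n)))"
    by (rule exists_unimodular_rotation)
  let ?E = "\<lambda>k l. if 2 * n \<le> k + l then cnj s * t k * t l * cnj (a k) * cnj (a l) * a (k + l - 2 * n) else 0"
  have pos: "1 + cmod (a 0) > 0" by (simp add: add_pos_nonneg)
  have "(\<Sum>k\<le>n. \<Sum>l\<le>n. ?E k l) = (\<Sum>k\<le>n. \<Sum>l\<le>n. if l = n then (if k = n then ?E n n else 0) else 0)"
    by (intro sum.cong refl) auto
  also have "\<dots> = ?E n n" by (simp add: sum.delta)
  finally have E: "(\<Sum>k\<le>n. \<Sum>l\<le>n. ?E k l) = cnj s * \<tau> * \<tau> * cnj (a n) * cnj (a n) * a 0"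
    by (simp add: t_def)
  have "cmod (cnj s * \<tau> * \<tau> * cnj (a n) * cnj (a n) * a 0) = \<tau>\<^sup>2 * (cmod (a n))\<^sup>2 * cmod (a 0)"
    using s(1) by (simp add: norm_mult power2_eq_square)
  then have "- Re (cnj s * \<tau> * \<tau> * cnj (a n) * cnj (a n) * a 0) \<le> \<tau>\<^sup>2 * (cmod (a n))\<^sup>2 * cmod (a 0)"
    by (metis abs_Re_le_cmod abs_le_D2)
  moreover have "(\<Sum>k\<le>n. t k * (cmod (a k))\<^sup>2) = (\<Sum>k<n. (cmod (a k))\<^sup>2) + \<tau> * (cmod (a n))\<^sup>2"
    by (simp add: t_def flip: lessThan_Suc_atMost)
  moreover have "(\<Sum>k\<le>n. (t k)\<^sup>2 * (cmod (a k))\<^sup>2) = (\<Sum>k<n. (cmod (a k))\<^sup>2) + \<tau>\<^sup>2 * (cmod (a n))\<^sup>2"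
    by (simp add: t_def flip: lessThan_Suc_atMost)
  moreover have "Re (s * a (2 * n)) + 2 * (\<Sum>k\<le>n. t k * (cmod (a k))\<^sup>2) + Re (\<Sum>k\<le>n. \<Sum>l\<le>n. ?E k l)
      \<le> 1 + (\<Sum>k\<le>n. (t k)\<^sup>2 * (cmod (a k))\<^sup>2)"
    using \<open>n > 0\<close> by (intro carlson_bilinear [OF _ s(1) assms(1,2)]) auto
  ultimately have "cmod (a (2 * n)) \<le> 1 - (\<Sum>k<n. (cmod (a k))\<^sup>2)
      + (\<tau>\<^sup>2 * (1 + cmod (a 0)) - 2 * \<tau>) * (cmod (a n))\<^sup>2"
    unfolding E s(2) by (simp add: algebra_simps)
  also have "\<tau>\<^sup>2 * (1 + cmod (a 0)) - 2 * \<tau> = - \<tau>"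
    using pos by (simp add: \<tau>_def power2_eq_square)
  finally show ?thesis by (simp add: \<tau>_def)
qed

text \<open>
  The third summand is the remainder of the telescoping: the geometric tail
  \<open>r\<^bsup>2M+1\<^esup> / (1 - r)\<close> carries the bounds on all coefficients of index above \<open>2M\<close>.
\<close>
lemma bohr_partial_sum_le:
  fixes c :: "nat \<Rightarrow> real"
  assumes odd: "\<And>n. c (2 * n + 1) \<le> 1 - (\<Sum>k\<le>n. (c k)\<^sup>2)"
    and even: "\<And>n. n > 0 \<Longrightarrow> c (2 * n) \<le> 1 - (\<Sum>k<n. (c k)\<^sup>2) - (c n)\<^sup>2 / (1 + c 0)"
    and r: "0 \<le> r" "r < 1"
  shows "(\<Sum>m<2 * M. c (Suc m) * r ^ Suc m)
     + (1 / (1 + c 0) + r / (1 - r)) * (\<Sum>m<M. (c (Suc m))\<^sup>2 * r ^ (2 * Suc m))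
     + (1 - (\<Sum>k\<le>M. (c k)\<^sup>2)) * (r ^ (2 * M + 1) / (1 - r))
    \<le> (1 - (c 0)\<^sup>2) * (r / (1 - r))"
proof (induction M)
  case 0
  then show ?case by simp
next
  case (Suc M)
  define S where "S = (\<Sum>k\<le>M. (c k)\<^sup>2)"
  define u where "u = (c (Suc M))\<^sup>2"
  define p where "p = r ^ (2 * M + 1)"
  define d where "d = 1 / (1 - r)"
  define e where "e = 1 / (1 + c 0)"
  have d: "d * (1 - r) = 1" using r by (simp add: d_def)
  have p: "p \<ge> 0" "p * r \<ge> 0" using r by (simp_all add: p_def)
  have "c (2 * M + 1) * p \<le> (1 - S) * p"
    using odd [of M] p by (intro mult_right_mono) (simp_all add: S_def)
  moreover have "c (2 * M + 2) * (p * r) \<le> (1 - S - u * e) * (p * r)"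
    using even [of "Suc M"] p by (intro mult_right_mono) (simp_all add: S_def u_def e_def lessThan_Suc_atMost)
  \<comment> \<open>The factor \<open>e + r * d\<close> of the quadratic series is tuned so that
    \<open>u\<close> cancels: \<open>e\<close> makes up for the loss in the even bound and
    \<open>r * d\<close> for the drop in the remainder. What is left is
    \<open>1 + r + r\<^sup>2 * d = d\<close>.\<close>
  moreover have "(1 - S) * p + (1 - S - u * e) * (p * r) + (e + r * d) * (u * (p * r))
      + (1 - S - u) * (p * r * r * d) = (1 - S) * (p * d)"
    using d by algebra
  ultimately have "c (2 * M + 1) * p + c (2 * M + 2) * (p * r) + (e + r * d) * (u * (p * r))
      + (1 - S - u) * (p * r * r * d) \<le> (1 - S) * (p * d)" by linarith
  moreover have "(\<Sum>m<2 * Suc M. c (Suc m) * r ^ Suc m)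
      = (\<Sum>m<2 * M. c (Suc m) * r ^ Suc m) + c (2 * M + 1) * p + c (2 * M + 2) * (p * r)"
    by (simp add: p_def)
  moreover have "(e + r * d) * (\<Sum>m<Suc M. (c (Suc m))\<^sup>2 * r ^ (2 * Suc m))
      = (e + r * d) * (\<Sum>m<M. (c (Suc m))\<^sup>2 * r ^ (2 * Suc m)) + (e + r * d) * (u * (p * r))"
    by (simp add: p_def u_def distrib_left)
  moreover have "(1 - (\<Sum>k\<le>Suc M. (c k)\<^sup>2)) * (r ^ (2 * Suc M + 1) * d) = (1 - S - u) * (p * r * r * d)"
    by (simp add: p_def u_def S_def)
  moreover have "(\<Sum>m<2 * M. c (Suc m) * r ^ Suc m)
     + (e + r * d) * (\<Sum>m<M. (c (Suc m))\<^sup>2 * r ^ (2 * Suc m)) + (1 - S) * (p * d)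
    \<le> (1 - (c 0)\<^sup>2) * (r * d)"
    using Suc.IH by (simp add: S_def p_def d_def e_def)
  ultimately have "(\<Sum>m<2 * Suc M. c (Suc m) * r ^ Suc m)
     + (e + r * d) * (\<Sum>m<Suc M. (c (Suc m))\<^sup>2 * r ^ (2 * Suc m))
     + (1 - (\<Sum>k\<le>Suc M. (c k)\<^sup>2)) * (r ^ (2 * Suc M + 1) * d) \<le> (1 - (c 0)\<^sup>2) * (r * d)"
    by linarith
  then show ?case by (simp only: d_def e_def times_divide_eq_right mult_1_right)
qed

lemma bohr_coefficient_bound:
  assumes coeffs: "has_coeffs f a" and bound: "\<And>z. cmod z < 1 \<Longrightarrow> cmod (f z) \<le> 1"
    and r: "0 \<le> r" "r < 1"
  shows "(\<Sum>n. cmod (a (Suc n)) * r ^ Suc n)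
     + (1 / (1 + cmod (a 0)) + r / (1 - r)) * (\<Sum>n. (cmod (a (Suc n)))\<^sup>2 * r ^ (2 * Suc n))
    \<le> (1 - (cmod (a 0))\<^sup>2) * (r / (1 - r))"
proof -
  let ?c = "\<lambda>n. cmod (a n)"
  let ?P = "\<lambda>n. ?c (Suc n) * r ^ Suc n" and ?Q = "\<lambda>n. (?c (Suc n))\<^sup>2 * r ^ (2 * Suc n)"
  let ?k = "1 / (1 + ?c 0) + r / (1 - r)"
  note odd = carlson_odd [OF coeffs bound] and even = carlson_even [OF coeffs bound]
  have S1: "(\<Sum>k\<le>n. (?c k)\<^sup>2) \<le> 1" for n
    using odd [of n] norm_ge_zero [of "a (2 * n + 1)"] by linarith
  have c1: "?c n \<le> 1" for n
  proof -
    have "(?c n)\<^sup>2 \<le> (\<Sum>k\<le>n. (?c k)\<^sup>2)" by (intro member_le_sum) auto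
    with S1 [of n] have "(?c n)\<^sup>2 \<le> 1\<^sup>2" by simp
    then show ?thesis by (rule power2_le_imp_le) simp
  qed
  have "summable (\<lambda>n. cmod (a n * of_real r ^ n))"
    using r by (intro has_coeffs_abs_summable [OF coeffs]) auto
  then have "summable (\<lambda>n. ?c n * r ^ n)" using r by (simp add: norm_mult norm_power)
  then have sP: "summable ?P" by (subst (asm) summable_Suc_iff [symmetric])
  have sQ: "summable ?Q"
  \<comment> \<open>Each term of the first series lies in [0, 1], so it dominates its own
    square.\<close>
  proof (rule summable_comparison_test' [OF sP])
    fix n
    have "(?c (Suc n) * r ^ Suc n)\<^sup>2 \<le> ?c (Suc n) * r ^ Suc n"
      using r c1 [of "Suc n"] power_le_one [of r "Suc n"]
      by (simp add: power2_eq_square mult_left_le_one_le mult_le_one del: power_Suc)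
    moreover have "?Q n = (?c (Suc n) * r ^ Suc n)\<^sup>2"
      by (simp only: power_mult_distrib power_even_eq)
    ultimately show "norm (?Q n) \<le> ?P n"
      by (simp only: real_norm_def abs_power2)
  qed
  have "(\<lambda>M. (\<Sum>m<2 * M. ?P m) + ?k * (\<Sum>m<M. ?Q m)) \<longlonglongrightarrow> suminf ?P + ?k * suminf ?Q"
  proof (intro tendsto_add tendsto_mult tendsto_const)
    have "filterlim (\<lambda>M::nat. 2 * M) at_top sequentially"
      by (rule mult_nat_left_at_top) simp
    then show "(\<lambda>M. \<Sum>m<2 * M. ?P m) \<longlonglongrightarrow> suminf ?P"
      by (rule filterlim_compose [OF summable_LIMSEQ [OF sP]])
    show "(\<lambda>M. \<Sum>m<M. ?Q m) \<longlonglongrightarrow> suminf ?Q" by (rule summable_LIMSEQ [OF sQ])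
  qed
  then show ?thesis
  proof (rule LIMSEQ_le_const2, intro exI allI impI)
    fix M
    have "0 \<le> (1 - (\<Sum>k\<le>M. (?c k)\<^sup>2)) * (r ^ (2 * M + 1) / (1 - r))"
      using S1 r by (intro mult_nonneg_nonneg) auto
    then show "(\<Sum>m<2 * M. ?P m) + ?k * (\<Sum>m<M. ?Q m) \<le> (1 - (?c 0)\<^sup>2) * (r / (1 - r))"
      using bohr_partial_sum_le [of ?c, OF odd even r, of M] by linarith
  qed
qed

subsection \<open>The sharp majorant\<close>

lemma class_B_norm_less:
  assumes "f \<in> class_B" "cmod z < 1"
  shows "cmod (f z) < 1"
proof -
  have "z \<in> ball 0 1" using assms(2) by simp
  then have "f z \<in> ball 0 1" using assms(1) unfolding class_B_def by blast
  then show ?thesis by simp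
qed

text \<open>Rests on the identity expressing the difference of the squared moduli of denominator and
  numerator as \<open>(1 - (cmod w)\<^sup>2) * (1 - (cmod v)\<^sup>2)\<close>.\<close>

lemma cmod_blaschke_factor_less:
  assumes "cmod w < 1" "cmod v < 1"
  shows "1 - cnj w * v \<noteq> 0" and "cmod ((v - w) / (1 - cnj w * v)) < 1"
proof -
  have "cmod (cnj w * v) < 1"
    using assms mult_strict_mono [of "cmod w" 1 "cmod v" 1] by (simp add: norm_mult)
  then show nz: "1 - cnj w * v \<noteq> 0" by auto
  have "(cmod (1 - cnj w * v))\<^sup>2 - (cmod (v - w))\<^sup>2 = (1 - (cmod w)\<^sup>2) * (1 - (cmod v)\<^sup>2)"
    unfolding cmod_power2 by (simp add: power2_eq_square algebra_simps)
  moreover have "(1 - (cmod w)\<^sup>2) * (1 - (cmod v)\<^sup>2) > 0"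
    using assms by (intro mult_pos_pos) (auto simp: power_less_one_iff)
  ultimately have "(cmod (v - w))\<^sup>2 < (cmod (1 - cnj w * v))\<^sup>2" by linarith
  then have "cmod (v - w) < cmod (1 - cnj w * v)" by (rule power2_less_imp_less) simp
  then show "cmod ((v - w) / (1 - cnj w * v)) < 1" using nz by (simp add: norm_divide)
qed

text \<open>The Schwarz lemma is applied to \<open>f\<close> followed by the disc automorphism that
  sends \<open>f 0\<close> to 0; the resulting inequality is then reduced to one between
  moduli.\<close>

lemma schwarz_pick_at_0:
  assumes "f \<in> class_B" "cmod z < 1"
  shows "cmod (f z) \<le> (cmod z + cmod (f 0)) / (1 + cmod (f 0) * cmod z)"
proof -
  define w where "w = f 0"
  define g where "g z = (f z - w) / (1 - cnj w * f z)" for z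
  have f1: "cmod (f z) < 1" if "cmod z < 1" for z
    using class_B_norm_less [OF assms(1) that] .
  then have w1: "cmod w < 1" by (simp add: w_def)
  have nz: "1 - cnj w * f z \<noteq> 0" if "cmod z < 1" for z
    using cmod_blaschke_factor_less(1) [OF w1 f1 [OF that]] .
  have "cmod (g z) \<le> cmod z"
  proof (rule Schwarz_Lemma(1))
    have "f holomorphic_on ball 0 1"
      using assms(1) by (simp add: class_B_def analytic_imp_holomorphic)
    then show "g holomorphic_on ball 0 1"
      unfolding g_def by (intro holomorphic_intros) (use nz in auto)
    show "g 0 = 0" by (simp add: g_def w_def)
    show "cmod (g z) < 1" if "cmod z < 1" for z
      using cmod_blaschke_factor_less(2) [OF w1 f1 [OF that]] by (simp add: g_def)
  qed (fact assms(2))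
  then have "cmod (f z - w) \<le> cmod z * cmod (1 - cnj w * f z)"
    using nz [OF assms(2)] by (simp add: g_def norm_divide field_simps)
  then have sq: "(cmod (f z - w))\<^sup>2 \<le> (cmod z)\<^sup>2 * (cmod (1 - cnj w * f z))\<^sup>2"
    by (metis norm_ge_zero power_mono power_mult_distrib)
  define F A r where "F = cmod (f z)" and "A = cmod w" and "r = cmod z"
  define t where "t = Re (cnj w * f z)"
  have t: "t \<le> A * F" unfolding t_def A_def F_def
    by (metis complex_Re_le_cmod complex_mod_cnj norm_mult)
  have e1: "(cmod (f z - w))\<^sup>2 = F\<^sup>2 + A\<^sup>2 - 2 * t"
    unfolding F_def A_def t_def cmod_power2 by (simp add: algebra_simps power2_eq_square)
  have e2: "(cmod (1 - cnj w * f z))\<^sup>2 = 1 + A\<^sup>2 * F\<^sup>2 - 2 * t"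
    unfolding F_def A_def t_def cmod_power2 by (simp add: algebra_simps power2_eq_square)
  have r: "0 \<le> r" "r < 1" and A: "0 \<le> A" "A < 1" and F: "0 \<le> F" "F < 1"
    using assms(2) w1 f1 by (auto simp: r_def A_def F_def)
  \<comment> \<open>After rearrangement \<open>t\<close> enters only through
    \<open>2 * t * (1 - r\<^sup>2)\<close> on the larger side, so it may be replaced by its bound
    \<open>A * F\<close>; both sides then become squares.\<close>
  have "2 * t * (1 - r\<^sup>2) \<le> 2 * (A * F) * (1 - r\<^sup>2)"
    using t r by (intro mult_right_mono) (auto simp: power_le_one)
  then have "(F - A)\<^sup>2 \<le> (r * (1 - A * F))\<^sup>2"
    using sq unfolding e1 e2 r_def [symmetric] by (simp add: power2_eq_square algebra_simps)
  moreover have "0 \<le> r * (1 - A * F)" using r A F by (simp add: mult_le_one)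
  ultimately have "F - A \<le> r * (1 - A * F)" by (rule power2_le_imp_le)
  then have "F * (1 + A * r) \<le> r + A" by (simp add: algebra_simps)
  moreover have "1 + A * r > 0" using r A by (simp add: add_pos_nonneg)
  ultimately show ?thesis by (simp add: F_def A_def r_def w_def pos_le_divide_eq)
qed

section \<open>The majorant and its extremal function\<close>

definition bohr_majorant :: "nat \<Rightarrow> real \<Rightarrow> real \<Rightarrow> real" where
  "bohr_majorant p \<alpha> r = ((r + \<alpha>) / (1 + \<alpha> * r)) ^ p + (1 - \<alpha>\<^sup>2) * (r / (1 - r))"

lemma bohr_sum_le_majorant:
  assumes f: "f \<in> class_B" and coeffs: "has_coeffs f a" and z: "cmod z < 1"
  shows "bohr_sum p f a z \<le> bohr_majorant p (cmod (a 0)) (cmod z)"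
proof -
  have f1: "cmod (f z) \<le> 1" if "cmod z < 1" for z
    using class_B_norm_less [OF f that] by simp
  have "cmod (f z) ^ p \<le> ((cmod z + cmod (a 0)) / (1 + cmod (a 0) * cmod z)) ^ p"
    using schwarz_pick_at_0 [OF f z] by (intro power_mono) (simp_all add: has_coeffs_0 [OF coeffs])
  then show ?thesis
    using bohr_coefficient_bound [OF coeffs f1, of "cmod z"] z
    by (simp add: bohr_sum_def bohr_majorant_def del: power_Suc)
qed

text \<open>Equality in the coefficient bound for the extremal function: with
  \<open>cmod (a (Suc n)) = (1 - \<alpha>\<^sup>2) * \<alpha> ^ n\<close> the two series are
  geometric, and their closed forms stand on the left.\<close>

lemma extremal_sum_identity:
  fixes \<alpha> r :: real
  assumes "\<alpha> * r \<noteq> 1" "\<alpha> * r \<noteq> -1" "r \<noteq> 1" "\<alpha> \<noteq> -1"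
  shows "(1 - \<alpha>\<^sup>2) * r / (1 - \<alpha> * r)
      + (1 / (1 + \<alpha>) + r / (1 - r)) * (((1 - \<alpha>\<^sup>2) * r)\<^sup>2 / (1 - (\<alpha> * r)\<^sup>2))
    = (1 - \<alpha>\<^sup>2) * (r / (1 - r))"
proof -
  define x y d e where "x = inverse (1 - \<alpha> * r)" and "y = inverse (1 + \<alpha> * r)"
    and "d = inverse (1 - r)" and "e = inverse (1 + \<alpha>)"
  have nz: "1 - \<alpha> * r \<noteq> 0" "1 + \<alpha> * r \<noteq> 0" "1 - r \<noteq> 0" "1 + \<alpha> \<noteq> 0"
    using assms by linarith+
  have x: "x * (1 - \<alpha> * r) = 1" unfolding x_def by (rule left_inverse [OF nz(1)])
  have y: "(1 + \<alpha> * r) * y = 1" unfolding y_def by (rule right_inverse [OF nz(2)])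
  have d: "d * (1 - r) = 1" unfolding d_def by (rule left_inverse [OF nz(3)])
  have e: "e * (1 + \<alpha>) = 1" unfolding e_def by (rule left_inverse [OF nz(4)])
  have factor: "1 - (\<alpha> * r)\<^sup>2 = (1 - \<alpha> * r) * (1 + \<alpha> * r)" by algebra
  have xy: "inverse (1 - (\<alpha> * r)\<^sup>2) = x * y"
    unfolding factor x_def y_def by (rule inverse_mult_distrib)
  \<comment> \<open>The numerator \<open>1 + \<alpha> * r\<close> cancels one of the two factors of
    \<open>1 - (\<alpha> * r)\<^sup>2\<close>.\<close>
  have k: "e + r * d = e * d * (1 + \<alpha> * r)" using d e by algebra
  have "(e + r * d) * (((1 - \<alpha>\<^sup>2) * r)\<^sup>2 * (x * y)) = e * d * ((1 + \<alpha> * r) * y) * ((1 - \<alpha>\<^sup>2) * r)\<^sup>2 * x"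
    unfolding k by (simp only: mult_ac)
  also have "\<dots> = e * d * ((1 - \<alpha>\<^sup>2) * r)\<^sup>2 * x" by (simp only: y mult_1_right)
  also have "\<dots> = (1 - \<alpha>\<^sup>2) * (1 - \<alpha>) * r\<^sup>2 * d * x" using e by algebra
  finally have "(1 - \<alpha>\<^sup>2) * r * x + (e + r * d) * (((1 - \<alpha>\<^sup>2) * r)\<^sup>2 * (x * y))
      = (1 - \<alpha>\<^sup>2) * r * x * (1 + (1 - \<alpha>) * r * d)" by algebra
  also have "1 + (1 - \<alpha>) * r * d = d * (1 - \<alpha> * r)" using d by algebra
  also have "(1 - \<alpha>\<^sup>2) * r * x * (d * (1 - \<alpha> * r)) = (1 - \<alpha>\<^sup>2) * (r * d)" using x by algebra
  finally show ?thesis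
    unfolding xy [symmetric] by (simp only: x_def d_def e_def divide_inverse mult_1)
qed

text \<open>The extremal function is the disc automorphism that exchanges 0 and \<alpha>. At
  \<open>- r\<close> numerator and denominator are both positive, so its modulus there is the
  Schwarz-Pick bound itself.\<close>

lemma bohr_sum_attains_majorant:
  assumes \<alpha>: "0 \<le> \<alpha>" "\<alpha> < 1" and r: "0 \<le> r" "r < 1"
  obtains f a where "f \<in> class_B" "has_coeffs f a" "cmod (f 0) = \<alpha>"
    "bohr_sum p f a (- of_real r) = bohr_majorant p \<alpha> r"
proof -
  define f where "f z = (of_real \<alpha> - z) / (1 - of_real \<alpha> * z)" for z :: complex
  define a where "a n = (case n of 0 \<Rightarrow> complex_of_real \<alpha> | Suc m \<Rightarrow> - of_real ((1 - \<alpha>\<^sup>2) * \<alpha> ^ m))" for n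
  have w1: "cmod (of_real \<alpha>) < 1" using \<alpha> by simp
  have nz: "1 - of_real \<alpha> * z \<noteq> 0" if "cmod z < 1" for z
    using cmod_blaschke_factor_less(1) [OF w1 that] by simp
  have "f holomorphic_on ball 0 1"
    unfolding f_def by (intro holomorphic_intros) (use nz in auto)
  then have "f analytic_on ball 0 1" by (simp add: analytic_on_open)
  moreover have "cmod (f z) < 1" if "cmod z < 1" for z
    using cmod_blaschke_factor_less(2) [OF w1 that] by (simp add: f_def norm_divide norm_minus_commute)
  ultimately have fB: "f \<in> class_B" by (auto simp: class_B_def)
  have coeffs: "has_coeffs f a"
    unfolding has_coeffs_def
  proof
    fix z :: complex assume "z \<in> ball 0 1"
    then have z: "cmod z < 1" by simp
    let ?q = "complex_of_real \<alpha> * z"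
    have "cmod ?q < 1"
      using \<alpha> z mult_strict_mono [of \<alpha> 1 "cmod z" 1] by (simp add: norm_mult)
    then have "(\<lambda>n. - of_real (1 - \<alpha>\<^sup>2) * z * ?q ^ n) sums (- of_real (1 - \<alpha>\<^sup>2) * z * (1 / (1 - ?q)))"
      by (intro sums_mult geometric_sums)
    moreover have "- of_real (1 - \<alpha>\<^sup>2) * z * ?q ^ n = a (Suc n) * z ^ Suc n" for n
      by (simp only: a_def nat.case power_mult_distrib of_real_mult of_real_power power_Suc) algebra
    moreover have "- of_real (1 - \<alpha>\<^sup>2) * z * (1 / (1 - ?q)) = f z - a 0 * z ^ 0"
      using nz [OF z] by (simp add: f_def a_def field_simps power2_eq_square)
    ultimately have "(\<lambda>n. a (Suc n) * z ^ Suc n) sums (f z - a 0 * z ^ 0)"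
      by (simp only:)
    then show "(\<lambda>n. a n * z ^ n) sums f z"
      by (simp only: sums_Suc_iff [of "\<lambda>n. a n * z ^ n"] diff_add_cancel)
  qed
  have f0: "cmod (f 0) = \<alpha>" using \<alpha> by (simp add: f_def)
  have \<alpha>r: "0 \<le> \<alpha> * r" "\<alpha> * r < 1"
    using \<alpha> r mult_strict_mono [of \<alpha> 1 r 1] by auto
  have \<alpha>2: "\<alpha>\<^sup>2 \<le> 1" using \<alpha> by (simp add: power_le_one)
  have ca: "cmod (a (Suc n)) = (1 - \<alpha>\<^sup>2) * \<alpha> ^ n" for n
    using \<alpha> \<alpha>2 unfolding a_def by (simp add: norm_mult norm_power del: of_real_mult of_real_power of_real_diff)
  have "(\<lambda>n. (1 - \<alpha>\<^sup>2) * r * (\<alpha> * r) ^ n) sums ((1 - \<alpha>\<^sup>2) * r * (1 / (1 - \<alpha> * r)))"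
    using \<alpha>r by (intro sums_mult geometric_sums) simp
  moreover have "(1 - \<alpha>\<^sup>2) * r * (\<alpha> * r) ^ n = cmod (a (Suc n)) * r ^ Suc n" for n
    by (simp add: ca power_mult_distrib mult_ac)
  ultimately have P: "(\<Sum>n. cmod (a (Suc n)) * r ^ Suc n) = (1 - \<alpha>\<^sup>2) * r / (1 - \<alpha> * r)"
    by (simp add: sums_iff)
  have "(\<lambda>n. ((1 - \<alpha>\<^sup>2) * r)\<^sup>2 * ((\<alpha> * r)\<^sup>2) ^ n) sums (((1 - \<alpha>\<^sup>2) * r)\<^sup>2 * (1 / (1 - (\<alpha> * r)\<^sup>2)))"
    using \<alpha>r by (intro sums_mult geometric_sums) (simp add: power_less_one_iff)
  moreover have "((1 - \<alpha>\<^sup>2) * r)\<^sup>2 * ((\<alpha> * r)\<^sup>2) ^ n = (cmod (a (Suc n)))\<^sup>2 * r ^ (2 * Suc n)" for n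
  proof -
    have "((\<alpha> * r)\<^sup>2) ^ n = ((\<alpha> * r) ^ n)\<^sup>2" by (simp only: mult.commute flip: power_mult)
    moreover have "r ^ (2 * Suc n) = (r * r ^ n)\<^sup>2" by (simp only: power_even_eq power_Suc)
    ultimately show ?thesis by (simp only: ca power_mult_distrib mult_ac)
  qed
  ultimately have Q: "(\<Sum>n. (cmod (a (Suc n)))\<^sup>2 * r ^ (2 * Suc n)) = ((1 - \<alpha>\<^sup>2) * r)\<^sup>2 / (1 - (\<alpha> * r)\<^sup>2)"
    by (simp add: sums_iff)
  have fr: "cmod (f (- of_real r)) = (r + \<alpha>) / (1 + \<alpha> * r)"
  proof -
    have "f (- of_real r) = of_real ((r + \<alpha>) / (1 + \<alpha> * r))" by (simp add: f_def add.commute)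
    then show ?thesis using \<alpha> r \<alpha>r by (simp only: norm_of_real) simp
  qed
  have "\<alpha> * r \<noteq> 1" "\<alpha> * r \<noteq> -1" "r \<noteq> 1" "\<alpha> \<noteq> -1"
    using \<alpha> r \<alpha>r by linarith+
  note identity = extremal_sum_identity [OF this]
  have a0: "cmod (a 0) = \<alpha>" using \<alpha> by (simp add: a_def)
  have nr: "cmod (- of_real r) = r" using r by simp
  have "bohr_sum p f a (- of_real r) = bohr_majorant p \<alpha> r"
    unfolding bohr_sum_def bohr_majorant_def a0 nr fr P Q identity [symmetric] by (rule add.assoc)
  with fB coeffs f0 show ?thesis by (rule that)
qed

subsection \<open>The two radii\<close>

text \<open>The factor \<open>1 - \<alpha>\<close> splits off; for \<open>\<alpha> < 1\<close> the
  comparison with 1 thus depends on the sign of a quadratic in \<open>r\<close>.\<close>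

lemma one_minus_majorant_1:
  assumes "0 \<le> \<alpha>" "0 \<le> r" "r < 1"
  shows "1 - bohr_majorant 1 \<alpha> r
    = (1 - \<alpha>) * (1 - (3 + \<alpha>) * r + (1 - \<alpha> - \<alpha>\<^sup>2) * r\<^sup>2) / ((1 + \<alpha> * r) * (1 - r))"
proof -
  have "1 + \<alpha> * r > 0" using assms by (simp add: add_pos_nonneg)
  then show ?thesis using assms
    by (simp add: bohr_majorant_def divide_simps) algebra
qed

lemma one_minus_majorant_2:
  assumes "0 \<le> \<alpha>" "0 \<le> r" "r < 1"
  shows "1 - bohr_majorant 2 \<alpha> r
    = (1 - \<alpha>\<^sup>2) * ((1 - \<alpha>\<^sup>2) * r ^ 3 - (1 + 2 * \<alpha>) * r\<^sup>2 - 2 * r + 1) / ((1 + \<alpha> * r)\<^sup>2 * (1 - r))"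
proof -
  have "1 + \<alpha> * r > 0" using assms by (simp add: add_pos_nonneg)
  then show ?thesis using assms
    by (simp add: bohr_majorant_def divide_simps) algebra
qed

text \<open>The quadratic is written as \<open>(1 - r * l1) * (1 - r * l2)\<close>, where
  \<open>l1\<close> and \<open>l2\<close> are the roots of the reversed quadratic, whose
  discriminant is \<open>5 * (1 + \<alpha>)\<^sup>2\<close>. This form survives a vanishing leading
  coefficient \<open>1 - \<alpha> - \<alpha>\<^sup>2\<close>. Since \<open>l2 < 1\<close>, the first
  factor alone decides the sign.\<close>

lemma majorant_1_le_1_iff:
  assumes \<alpha>: "0 \<le> \<alpha>" "\<alpha> < 1" and r: "0 \<le> r" "r < 1"
  shows "bohr_majorant 1 \<alpha> r \<le> 1 \<longleftrightarrow> r \<le> radius1 \<alpha>"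
proof -
  define q :: real where "q = sqrt 5"
  have q: "q\<^sup>2 = 5" "q > 1" by (simp_all add: q_def)
  define l1 where "l1 = (3 + \<alpha> + q * (1 + \<alpha>)) / 2"
  define l2 where "l2 = (3 + \<alpha> - q * (1 + \<alpha>)) / 2"
  have l1: "l1 > 0" using \<alpha> q by (simp add: l1_def add_pos_nonneg)
  have "(q - 1) * (1 + \<alpha>) > 0" using \<alpha> q by simp
  then have "l2 < 1" by (simp add: l2_def algebra_simps)
  then have "r * l2 \<le> r" using r by (simp add: mult_left_le)
  then have l2: "1 - r * l2 > 0" using r by linarith
  define D where "D = (1 + \<alpha> * r) * (1 - r)"
  have pos: "D > 0" unfolding D_def using \<alpha> r by (simp add: add_pos_nonneg)
  have "1 - (3 + \<alpha>) * r + (1 - \<alpha> - \<alpha>\<^sup>2) * r\<^sup>2 = (1 - r * l1) * (1 - r * l2)"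
  proof -
    have "l1 + l2 = 3 + \<alpha>" by (simp add: l1_def l2_def field_simps)
    moreover have "l1 * l2 = ((3 + \<alpha>)\<^sup>2 - q\<^sup>2 * (1 + \<alpha>)\<^sup>2) / 4"
      by (simp add: l1_def l2_def power2_eq_square algebra_simps)
    then have "l1 * l2 = 1 - \<alpha> - \<alpha>\<^sup>2"
      unfolding q(1) by (simp add: power2_eq_square algebra_simps)
    ultimately show ?thesis by algebra
  qed
  then have "1 - bohr_majorant 1 \<alpha> r = (1 - \<alpha>) * ((1 - r * l1) * (1 - r * l2)) / D"
    unfolding D_def using one_minus_majorant_1 \<alpha> r by simp
  then have "bohr_majorant 1 \<alpha> r \<le> 1 \<longleftrightarrow> 0 \<le> (1 - \<alpha>) * ((1 - r * l1) * (1 - r * l2)) / D"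
    by linarith
  also have "\<dots> \<longleftrightarrow> r * l1 \<le> 1"
    using pos l2 \<alpha> by (simp add: zero_le_divide_iff zero_le_mult_iff)
  also have "\<dots> \<longleftrightarrow> r \<le> 1 / l1" using l1 by (simp add: pos_le_divide_eq)
  also have "1 / l1 = radius1 \<alpha>" by (simp add: radius1_def l1_def q_def)
  finally show ?thesis .
qed

lemma radius1_bounds:
  assumes "0 \<le> \<alpha>" "\<alpha> < 1"
  shows "sqrt 5 - 2 \<le> radius1 \<alpha>" "0 < radius1 \<alpha>" "radius1 \<alpha> < 1"
proof -
  define q :: real where "q = sqrt 5"
  have q: "q * q = 5" "q > 0" by (simp_all add: q_def)
  have D: "3 + \<alpha> + q * (1 + \<alpha>) > 2" using assms q by (simp add: add_pos_nonneg)
  then show "0 < radius1 \<alpha>" "radius1 \<alpha> < 1" by (simp_all add: radius1_def q_def)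
  \<comment> \<open>The denominator grows with \<alpha>; the left side is the limiting value at
    \<open>\<alpha> = 1\<close>, equal to \<open>q - 2\<close>.\<close>
  have "2 / (4 + 2 * q) \<le> 2 / (3 + \<alpha> + q * (1 + \<alpha>))"
  proof (rule divide_left_mono)
    have "q * (1 + \<alpha>) \<le> q * 2" using assms q by (intro mult_left_mono) auto
    then show "3 + \<alpha> + q * (1 + \<alpha>) \<le> 4 + 2 * q" using assms by linarith
  qed (use D q in auto)
  moreover have "q - 2 = 2 / (4 + 2 * q)" using q by (simp add: field_simps)
  ultimately show "sqrt 5 - 2 \<le> radius1 \<alpha>" by (simp add: radius1_def q_def)
qed

section \<open>The cubic and its root\<close>

definition cubic :: "real \<Rightarrow> real \<Rightarrow> real" where
  "cubic \<alpha> r = (1 - \<alpha>\<^sup>2) * r ^ 3 - (1 + 2 * \<alpha>) * r\<^sup>2 - 2 * r + 1"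

text \<open>The difference of the two values is \<open>r - s\<close> times \<open>2 + Y - X\<close>,
  and this factor is at least 1 because \<open>X \<le> r + s + 1\<close> and
  \<open>Y \<ge> r + s\<close> on the unit interval.\<close>

lemma cubic_strict_decreasing:
  assumes "0 \<le> \<alpha>" "\<alpha> < 1" "0 \<le> s" "s < r" "r \<le> 1"
  shows "cubic \<alpha> r < cubic \<alpha> s"
proof -
  have r: "0 \<le> r" "s \<le> 1" using assms by auto
  have "r\<^sup>2 + r * s + s\<^sup>2 \<le> r + 1 + s"
    using assms r by (simp add: power2_eq_square mult_left_le mult_le_one add_mono)
  moreover define X where "X = (1 - \<alpha>\<^sup>2) * (r\<^sup>2 + r * s + s\<^sup>2)"
  moreover have "X \<le> r\<^sup>2 + r * s + s\<^sup>2"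
    unfolding X_def using assms r by (intro mult_left_le_one_le) (auto simp: power_le_one)
  moreover define Y where "Y = (1 + 2 * \<alpha>) * (r + s)"
  moreover have "r + s \<le> Y"
    using mult_right_mono [of 1 "1 + 2 * \<alpha>" "r + s"] assms r by (simp add: Y_def)
  ultimately have "0 < 2 + Y - X" by linarith
  then have "0 < 2 + (1 + 2 * \<alpha>) * (r + s) - (1 - \<alpha>\<^sup>2) * (r\<^sup>2 + r * s + s\<^sup>2)"
    by (simp only: X_def Y_def)
  then have "0 < (r - s) * (2 + (1 + 2 * \<alpha>) * (r + s) - (1 - \<alpha>\<^sup>2) * (r\<^sup>2 + r * s + s\<^sup>2))"
    using assms by simp
  also have "\<dots> = cubic \<alpha> s - cubic \<alpha> r" unfolding cubic_def by algebra
  finally show ?thesis by simp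
qed

text \<open>The cubic is positive at \<open>1 / 3\<close> and negative at
  \<open>1 / (2 + \<alpha>)\<close>, as its values factor explicitly, so a root lies strictly
  between. Monotonicity makes it unique, which gives the description operator in
  \<open>radius2\<close> its meaning.\<close>

lemma radius2_properties:
  assumes \<alpha>: "0 \<le> \<alpha>" "\<alpha> < 1"
  shows ex1_root2: "\<exists>!r. is_root2 \<alpha> r"
    and is_root2_radius2: "is_root2 \<alpha> (radius2 \<alpha>)"
    and radius2_gt: "1 / 3 < radius2 \<alpha>"
    and radius2_less: "radius2 \<alpha> < 1 / (2 + \<alpha>)"
proof -
  let ?u = "1 / (2 + \<alpha>)"
  have u: "1 / 3 \<le> ?u" "?u < 1" using \<alpha> by (auto simp: field_simps)
  have "27 * cubic \<alpha> v = (7 + \<alpha>) * (1 - \<alpha>)" if "3 * v = 1" for v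
    unfolding cubic_def using that by algebra
  from this [of "1 / 3"] have "27 * cubic \<alpha> (1 / 3) = (7 + \<alpha>) * (1 - \<alpha>)" by simp
  moreover have "(7 + \<alpha>) * (1 - \<alpha>) > 0" using \<alpha> by simp
  ultimately have c3: "cubic \<alpha> (1 / 3) > 0" by linarith
  have "?u * (2 + \<alpha>) = 1" using \<alpha> by simp
  then have "cubic \<alpha> ?u * (2 + \<alpha>) ^ 3 = - ((1 + \<alpha>) * (1 - \<alpha>\<^sup>2))"
    unfolding cubic_def by algebra
  moreover have "(1 + \<alpha>) * (1 - \<alpha>\<^sup>2) > 0"
    using \<alpha> by (intro mult_pos_pos) (auto simp: power_less_one_iff)
  ultimately have "cubic \<alpha> ?u * (2 + \<alpha>) ^ 3 < 0" by simp
  then have cu: "cubic \<alpha> ?u < 0"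
    using \<alpha> by (simp add: mult_less_0_iff)
  have "continuous_on {1 / 3..?u} (cubic \<alpha>)" unfolding cubic_def by (intro continuous_intros)
  then obtain x where x: "1 / 3 \<le> x" "x \<le> ?u" "cubic \<alpha> x = 0"
    using IVT2' [of "cubic \<alpha>" ?u 0 "1 / 3"] c3 cu u by auto
  then have strict: "1 / 3 < x" "x < ?u" using c3 cu by (metis less_eq_real_def less_irrefl)+
  have root: "is_root2 \<alpha> x" using x u strict by (simp add: is_root2_def cubic_def)
  have uniq: "y = x" if "is_root2 \<alpha> y" for y
    using cubic_strict_decreasing [OF \<alpha>, of x y] cubic_strict_decreasing [OF \<alpha>, of y x] that root
    by (force simp: is_root2_def cubic_def)
  show "\<exists>!r. is_root2 \<alpha> r" using root uniq by blast
  have "radius2 \<alpha> = x" unfolding radius2_def using root uniq by (rule the_equality)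
  then show "is_root2 \<alpha> (radius2 \<alpha>)" "1 / 3 < radius2 \<alpha>" "radius2 \<alpha> < ?u"
    using root strict by simp_all
qed

lemma majorant_2_le_1_iff:
  assumes \<alpha>: "0 \<le> \<alpha>" "\<alpha> < 1" and r: "0 \<le> r" "r < 1"
  shows "bohr_majorant 2 \<alpha> r \<le> 1 \<longleftrightarrow> r \<le> radius2 \<alpha>"
proof -
  have root: "cubic \<alpha> (radius2 \<alpha>) = 0" "0 < radius2 \<alpha>" "radius2 \<alpha> < 1"
    using is_root2_radius2 [OF \<alpha>] by (simp_all add: is_root2_def cubic_def)
  define C D where "C = 1 - \<alpha>\<^sup>2" and "D = (1 + \<alpha> * r)\<^sup>2 * (1 - r)"
  have "D > 0" unfolding D_def using \<alpha> r
    by (intro mult_pos_pos zero_less_power) (auto simp: add_pos_nonneg)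
  moreover have "C > 0" unfolding C_def using \<alpha> by (simp add: power_less_one_iff)
  ultimately have "0 \<le> C * cubic \<alpha> r / D \<longleftrightarrow> 0 \<le> cubic \<alpha> r"
    by (simp add: zero_le_divide_iff zero_le_mult_iff)
  moreover have "1 - bohr_majorant 2 \<alpha> r = C * cubic \<alpha> r / D"
    unfolding cubic_def C_def D_def using one_minus_majorant_2 \<alpha> r by blast
  then have "bohr_majorant 2 \<alpha> r \<le> 1 \<longleftrightarrow> 0 \<le> C * cubic \<alpha> r / D" by linarith
  \<comment> \<open>A strictly decreasing function changes sign only at its root.\<close>
  moreover have "0 \<le> cubic \<alpha> r \<longleftrightarrow> r \<le> radius2 \<alpha>"
    using cubic_strict_decreasing [OF \<alpha>, of "radius2 \<alpha>" r] cubic_strict_decreasing [OF \<alpha>, of r "radius2 \<alpha>"] root r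
    by (cases r "radius2 \<alpha>" rule: linorder_cases) auto
  ultimately show ?thesis by simp
qed

lemma best_possibleI:
  assumes iff: "\<And>\<alpha> r. 0 \<le> \<alpha> \<Longrightarrow> \<alpha> < 1 \<Longrightarrow> 0 \<le> r \<Longrightarrow> r < 1 \<Longrightarrow> bohr_majorant p \<alpha> r \<le> 1 \<longleftrightarrow> r \<le> \<rho> \<alpha>"
    and bounds: "\<And>\<alpha>. 0 \<le> \<alpha> \<Longrightarrow> \<alpha> < 1 \<Longrightarrow> 0 < \<rho> \<alpha> \<and> \<rho> \<alpha> < 1"
  shows "best_possible p \<rho>"
  unfolding best_possible_def
proof (intro ballI allI impI notI)
  fix \<alpha> R assume "\<alpha> \<in> {0..<1}" and R: "\<rho> \<alpha> < R" and holds: "bohr_holds p \<alpha> R"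
  then have \<alpha>: "0 \<le> \<alpha>" "\<alpha> < 1" by auto
  \<comment> \<open>\<open>R\<close> may exceed 1, so the point beyond the radius is also kept
    inside the disc, where the extremal function is available.\<close>
  obtain r where r: "\<rho> \<alpha> < r" "r < min R 1"
    using dense [of "\<rho> \<alpha>" "min R 1"] R bounds [OF \<alpha>] by auto
  then have r01: "0 \<le> r" "r < 1" using bounds [OF \<alpha>] by auto
  obtain f a where fa: "f \<in> class_B" "has_coeffs f a" "cmod (f 0) = \<alpha>"
    "bohr_sum p f a (- of_real r) = bohr_majorant p \<alpha> r"
    using bohr_sum_attains_majorant [OF \<alpha> r01] by blast
  have "- complex_of_real r \<in> ball 0 1" "cmod (- complex_of_real r) \<le> R" using r r01 by auto
  then have "bohr_majorant p \<alpha> r \<le> 1"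
    using holds fa unfolding bohr_holds_def by metis
  with iff [OF \<alpha> r01] r show False by simp
qed

theorem theorem2:
  fixes f :: "complex \<Rightarrow> complex" and a :: "nat \<Rightarrow> complex"
  assumes "f \<in> class_B" and "has_coeffs f a"
  shows "(\<forall>z. cmod z \<le> radius1 (cmod (a 0)) \<longrightarrow> bohr_sum 1 f a z \<le> 1)
    \<and> best_possible 1 radius1
    \<and> sqrt 5 - 2 \<le> radius1 (cmod (a 0))
    \<and> (\<exists>!r. is_root2 (cmod (a 0)) r)
    \<and> (\<forall>z. cmod z \<le> radius2 (cmod (a 0)) \<longrightarrow> bohr_sum 2 f a z \<le> 1)
    \<and> best_possible 2 radius2
    \<and> 1 / 3 < radius2 (cmod (a 0))
    \<and> radius2 (cmod (a 0)) < 1 / (2 + cmod (a 0))"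
proof -
  let ?\<alpha> = "cmod (a 0)"
  have "cmod (f 0) < 1" using class_B_norm_less [OF assms(1)] by simp
  then have \<alpha>: "0 \<le> ?\<alpha>" "?\<alpha> < 1" using has_coeffs_0 [OF assms(2)] by auto
  have radius2_01: "0 < radius2 \<alpha> \<and> radius2 \<alpha> < 1" if "0 \<le> \<alpha>" "\<alpha> < 1" for \<alpha>
    using is_root2_radius2 [OF that] by (simp add: is_root2_def)
  have "bohr_sum 1 f a z \<le> 1" if "cmod z \<le> radius1 ?\<alpha>" for z
  proof -
    have z: "cmod z < 1" using that radius1_bounds(3) [OF \<alpha>] by simp
    then show ?thesis
      using bohr_sum_le_majorant [OF assms z, of 1] majorant_1_le_1_iff [OF \<alpha>, of "cmod z"] that by simp
  qed
  moreover have "bohr_sum 2 f a z \<le> 1" if "cmod z \<le> radius2 ?\<alpha>" for z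
  proof -
    have z: "cmod z < 1" using that radius2_01 [OF \<alpha>] by simp
    then show ?thesis
      using bohr_sum_le_majorant [OF assms z, of 2] majorant_2_le_1_iff [OF \<alpha>, of "cmod z"] that by simp
  qed
  moreover have "best_possible 1 radius1"
    by (rule best_possibleI) (use majorant_1_le_1_iff radius1_bounds in auto)
  moreover have "best_possible 2 radius2"
    by (rule best_possibleI) (use majorant_2_le_1_iff radius2_01 in auto)
  ultimately show ?thesis
    using radius1_bounds(1) [OF \<alpha>] ex1_root2 [OF \<alpha>] radius2_gt [OF \<alpha>] radius2_less [OF \<alpha>] by blast
qed

end
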